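(* Let $X$ be a finite set such that $n=|X|\geq 3$ is odd. Then: (1) If $n$ is prime, then the diameter of the commuting graph $\mathcal{G}(\mathcal{I}(X))$ is $\infty$. (2) If $n$ is composite, then the diameter of $\mathcal{G}(\mathcal{I}(X))$ is either $4$ or $5$.
   Context: For a finite set $X$, $\mathcal{I}(X)$ is the symmetric inverse semigroup on $X$: all partial injective transformations of $X$ (injective functions whose domain and image are subsets of $X$) under composition of partial functions. The commuting graph $\mathcal{G}(S)$ of a finite non-commutative semigroup $S$ is the simple graph whose vertices are the elements of $S$ not in the center $Z(S)=\{a\in S: ab=ba\text{ for all }b\in S\}$, two distinct vertices $a,b$ being adjacent iff $ab=ba$. The diameter of a graph is the maximum distance between two of its vertices, where distance is the length (number of edges) of a shortest path, or $\infty$ if no path exists; so the diameter is $\infty$ iff the graph is not connected. *)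

theory Defs
  imports
    "Graph_Theory.Pair_Digraph"
    "HOL-Library.Extended_Nat"
    "HOL-Computational_Algebra.Primes"
begin

section \<open>The symmetric inverse semigroup\<close>

text \<open>
  Partial transformations are maps, with \<open>None\<close> for "undefined"; hence \<open>inj_on f (dom f)\<close> is
  injectivity of the partial function. The product is \<open>(\<circ>\<^sub>m)\<close>, which composes from right to
  left. Composing from left to right gives the opposite semigroup, which has the same commuting
  pairs, so the choice does not affect the commuting graph.
\<close>

definition sym_inv :: "'a set \<Rightarrow> ('a \<rightharpoonup> 'a) set" where
  "sym_inv X = {f. dom f \<subseteq> X \<and> ran f \<subseteq> X \<and> inj_on f (dom f)}"

lemma map_comp_in_sym_inv:
  assumes "f \<in> sym_inv X" "g \<in> sym_inv X"
  shows "f \<circ>\<^sub>m g \<in> sym_inv X"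
proof -
  have "inj_on (f \<circ>\<^sub>m g) (dom (f \<circ>\<^sub>m g))"
  proof (rule inj_onI)
    fix x y assume "x \<in> dom (f \<circ>\<^sub>m g)" "y \<in> dom (f \<circ>\<^sub>m g)" and eq: "(f \<circ>\<^sub>m g) x = (f \<circ>\<^sub>m g) y"
    then obtain a b c where *: "g x = Some a" "f a = Some c" "g y = Some b" "f b = Some c"
      by (auto simp: map_comp_Some_iff)
    then have "a = b"
      using assms(1) by (auto simp: sym_inv_def dest: inj_onD[of f "dom f" a b])
    with * show "x = y"
      using assms(2) by (auto simp: sym_inv_def dest: inj_onD[of g "dom g" x y])
  qed
  moreover have "dom (f \<circ>\<^sub>m g) \<subseteq> dom g" "ran (f \<circ>\<^sub>m g) \<subseteq> ran f"
    by (auto simp: ran_def map_comp_Some_iff)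
  ultimately show ?thesis using assms unfolding sym_inv_def by blast
qed

section \<open>Commuting graphs\<close>

text \<open>A semigroup is given by its carrier \<open>S\<close> and its multiplication \<open>m\<close>.\<close>

definition semigroup_center :: "'s set \<Rightarrow> ('s \<Rightarrow> 's \<Rightarrow> 's) \<Rightarrow> 's set" where
  "semigroup_center S m = {a \<in> S. \<forall>b\<in>S. m a b = m b a}"

text \<open>Simple graphs are loop-free symmetric digraphs, as in \<^locale>\<open>pair_graph\<close>.\<close>

definition commuting_graph :: "'s set \<Rightarrow> ('s \<Rightarrow> 's \<Rightarrow> 's) \<Rightarrow> 's pair_pre_digraph" where
  "commuting_graph S m =
    \<lparr> pverts = S - semigroup_center S m,
      parcs = {(a, b). a \<in> S - semigroup_center S m \<and> b \<in> S - semigroup_center S m \<and>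
                       a \<noteq> b \<and> m a b = m b a} \<rparr>"

lemma pair_graph_commuting_graph:
  assumes "finite S"
  shows "pair_graph (commuting_graph S m)"
proof -
  have "finite (parcs (commuting_graph S m))"
    by (rule finite_subset[of _ "S \<times> S"]) (auto simp: commuting_graph_def assms)
  then show ?thesis
    using assms by unfold_locales
      (auto simp: commuting_graph_def symmetric_def sym_def)
qed

section \<open>Distance and diameter\<close>

text \<open>
  Paths are \<^const>\<open>pre_digraph.apath\<close> (walks without repeated vertices), given as lists of arcs. The
  infimum of the empty set is \<open>\<infinity>\<close>, the distance between vertices not joined by a path. For a
  finite nonempty graph the supremum in \<open>diameter\<close> is attained, i.e. it is a maximum.
\<close>

definition distance :: "'v pair_pre_digraph \<Rightarrow> 'v \<Rightarrow> 'v \<Rightarrow> enat" where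
  "distance G u v = (INF p \<in> {p. pre_digraph.apath (with_proj G) u p v}. enat (length p))"

definition diameter :: "'v pair_pre_digraph \<Rightarrow> enat" where
  "diameter G = (SUP (u, v) \<in> pverts G \<times> pverts G. distance G u v)"

end

theory Submission
  imports Defs "HOL-Combinatorics.Cycles"
begin

text \<open>
  The vertices are the partial injections other than the empty map and the identity. The
  centralizer of an \<open>n\<close>-cycle consists of its powers and the empty map. If \<open>n\<close> is prime, the
  nontrivial powers are again \<open>n\<close>-cycles, so the component of an \<open>n\<close>-cycle contains only
  \<open>n\<close>-cycles. Likewise an \<open>n\<close>-chain (a nilpotent map with one orbit) commutes only with its
  powers, and for suitable numberings no nontrivial power of a chain commutes with one of a cycle,
  so the two are at distance at least 4. For the upper bound, a map commutes with the identity on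
  \<open>A\<close> iff \<open>A\<close> is a union of its components. Every map other than a chain or an \<open>n\<close>-cycle has a
  proper such \<open>A\<close>, and so do the square of a chain and a suitable power of an \<open>n\<close>-cycle for
  composite \<open>n\<close>; partial identities commute with each other, which gives a path of length 5.
\<close>

section \<open>Distance and walks\<close>

text \<open>Distances are measured by paths without repeated vertices, while the constructions below
  give walks; cutting out cycles only shortens a walk.\<close>

lemma (in wf_digraph) apath_of_awalk_length_le:
  assumes "awalk u p v"
  shows "\<exists>q. apath u q v \<and> length q \<le> length p"
proof -
  have "length (awalk_to_apath p) \<le> length p"
    using assms
  proof (induct rule: awalk_to_apath_induct)
    case (path p)
    then have "awalk_to_apath p = p"
      by (auto simp: awalk_to_apath.simps)
    then show ?case by simp
  next
    case (decomp p q r s)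
    then have "p = q @ r @ s"
      by (auto dest: awalk_cyc_decomp_has_prop)
    with decomp show ?case
      using step_awalk_to_apath[of _ p _ q r s] by auto
  qed
  with apath_awalk_to_apath[OF assms] show ?thesis by blast
qed

lemma (in wf_digraph) awalk_refl_step:
  assumes "awalk v p w" "u \<in> verts G" "u = v \<or> (\<exists>e. e \<in> arcs G \<and> tail G e = u \<and> head G e = v)"
  shows "\<exists>q. awalk u q w \<and> length q \<le> Suc (length p)"
proof (cases "u = v")
  case True
  then show ?thesis using assms(1) by (auto intro: exI[of _ p])
next
  case False
  with assms obtain e where "e \<in> arcs G" "tail G e = u" "head G e = v" by blast
  then have "awalk u (e # p) w" using assms(1) by (simp add: awalk_Cons_iff)
  then show ?thesis by (intro exI[of _ "e # p"]) simp
qed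

section \<open>Walks in commuting graphs\<close>

lemma verts_commuting_graph:
  "pverts (commuting_graph S m) = S - semigroup_center S m"
  by (simp add: commuting_graph_def)

text \<open>Every element commutes with itself, so \<open>u = v\<close> is allowed and costs no arc.
  Later paths therefore need no distinctness of their vertices; the price is an inequality for the
  length.\<close>

lemma awalk_commuting_step:
  assumes "finite S" "pre_digraph.awalk (with_proj (commuting_graph S m)) v p w"
    "u \<in> S - semigroup_center S m" "m u v = m v u"
  shows "\<exists>q. pre_digraph.awalk (with_proj (commuting_graph S m)) u q w \<and> length q \<le> Suc (length p)"
proof -
  interpret pair_graph "commuting_graph S m"
    using assms(1) by (rule pair_graph_commuting_graph)
  have "v \<in> S - semigroup_center S m"
    using awalk_hd_in_verts[OF assms(2)] by (simp add: verts_commuting_graph)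
  with assms(3,4) have "u = v \<or> (u, v) \<in> parcs (commuting_graph S m)"
    by (auto simp: commuting_graph_def)
  then show ?thesis
    using awalk_refl_step[OF assms(2), of u] assms(3) by (auto simp: verts_commuting_graph)
qed

text \<open>Splits off the first step of a walk. An empty walk is padded with \<open>v = u\<close>,
  so all walks of length at most \<open>Suc k\<close> are treated alike.\<close>

lemma awalk_commuting_unstep:
  assumes "finite S" "pre_digraph.awalk (with_proj (commuting_graph S m)) u p w" "length p \<le> Suc k"
  shows "\<exists>v q. v \<in> S - semigroup_center S m \<and> m u v = m v u \<and>
    pre_digraph.awalk (with_proj (commuting_graph S m)) v q w \<and> length q \<le> k"
proof -
  interpret pair_graph "commuting_graph S m"
    using assms(1) by (rule pair_graph_commuting_graph)
  show ?thesis
  proof (cases p)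
    case Nil
    then show ?thesis using assms(2)
      by (intro exI[of _ u] exI[of _ "[]"]) (auto simp: awalk_Nil_iff verts_commuting_graph)
  next
    case (Cons e es)
    then have e: "e \<in> parcs (commuting_graph S m)" "u = fst e" "awalk (snd e) es w"
      using assms(2) by (auto simp: awalk_Cons_iff)
    then show ?thesis using Cons assms(3)
      by (intro exI[of _ "snd e"] exI[of _ es]) (auto simp: commuting_graph_def)
  qed
qed

lemma distance_commuting_graph_le_5:
  assumes "finite S" "{a, b, c, d, e, f} \<subseteq> S - semigroup_center S m"
    "m a b = m b a" "m b c = m c b" "m c d = m d c" "m d e = m e d" "m e f = m f e"
  shows "distance (commuting_graph S m) a f \<le> 5"
proof -
  let ?G = "commuting_graph S m"
  interpret pair_graph ?G
    using assms(1) by (rule pair_graph_commuting_graph)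
  have "awalk f [] f" using assms(2) by (simp add: awalk_Nil_iff verts_commuting_graph)
  from awalk_commuting_step[OF assms(1) this, of e] assms(2,7)
  obtain p1 where p1: "awalk e p1 f" "length p1 \<le> 1" by auto
  from awalk_commuting_step[OF assms(1) p1(1), of d] assms(2,6) p1(2)
  obtain p2 where p2: "awalk d p2 f" "length p2 \<le> 2" by force
  from awalk_commuting_step[OF assms(1) p2(1), of c] assms(2,5) p2(2)
  obtain p3 where p3: "awalk c p3 f" "length p3 \<le> 3" by force
  from awalk_commuting_step[OF assms(1) p3(1), of b] assms(2,4) p3(2)
  obtain p4 where p4: "awalk b p4 f" "length p4 \<le> 4" by force
  from awalk_commuting_step[OF assms(1) p4(1), of a] assms(2,3) p4(2)
  obtain p5 where p5: "awalk a p5 f" "length p5 \<le> 5" by force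
  from apath_of_awalk_length_le[OF p5(1)] p5(2)
  obtain q where q: "apath a q f" "length q \<le> 5" by auto
  have "distance ?G a f \<le> enat (length q)"
    unfolding distance_def using q(1) by (intro INF_lower) simp
  also have "\<dots> \<le> enat 5" using q(2) by simp
  finally show ?thesis by (simp add: numeral_eq_enat)
qed

text \<open>Padded by repetitions, a walk of length at most 3 has the form \<open>a, x, y, b\<close>
  with consecutive elements commuting.\<close>

lemma distance_commuting_graph_ge_4:
  assumes "finite S"
    and no_path: "\<And>x y. x \<in> S - semigroup_center S m \<Longrightarrow> y \<in> S - semigroup_center S m \<Longrightarrow>
      m a x = m x a \<Longrightarrow> m y b = m b y \<Longrightarrow> m x y \<noteq> m y x"
  shows "4 \<le> distance (commuting_graph S m) a b"
  unfolding distance_def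
proof (rule INF_greatest)
  interpret pair_graph "commuting_graph S m"
    using assms(1) by (rule pair_graph_commuting_graph)
  fix p assume "p \<in> {p. apath a p b}"
  then have p: "awalk a p b" by (simp add: awalkI_apath)
  have "\<not> length p \<le> 3"
  proof
    assume "length p \<le> 3"
    with awalk_commuting_unstep[OF assms(1) p, of 2]
    obtain x q where x: "x \<in> S - semigroup_center S m" "m a x = m x a" "awalk x q b" "length q \<le> 2"
      by force
    from awalk_commuting_unstep[OF assms(1) x(3), of 1] x(4)
    obtain y r where y: "y \<in> S - semigroup_center S m" "m x y = m y x" "awalk y r b" "length r \<le> 1"
      by force
    from awalk_commuting_unstep[OF assms(1) y(3), of 0] y(4)
    obtain z s where z: "m y z = m z y" "awalk z s b" "length s \<le> 0"
      by force
    then have "z = b" by (simp add: awalk_Nil_iff)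
    with no_path[OF x(1) y(1) x(2)] z(1) y(2) show False by simp
  qed
  then have "4 \<le> length p" by simp
  then show "4 \<le> enat (length p)" by (simp add: numeral_eq_enat)
qed

text \<open>A property inherited by neighbours holds on the whole component of \<open>a\<close>, so
  no path leads to \<open>b\<close> and the infimum ranges over the empty set.\<close>

lemma distance_commuting_graph_infinite:
  assumes "finite S" "P a" "\<not> P b"
    and closed: "\<And>x y. P x \<Longrightarrow> y \<in> S - semigroup_center S m \<Longrightarrow> m x y = m y x \<Longrightarrow> P y"
  shows "distance (commuting_graph S m) a b = \<infinity>"
proof -
  interpret pair_graph "commuting_graph S m"
    using assms(1) by (rule pair_graph_commuting_graph)
  have "P w" if "awalk u p w" "P u" for u p w
    using that
  proof (induction p arbitrary: u)
    case Nil
    then show ?case by (simp add: awalk_Nil_iff)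
  next
    case (Cons e p)
    then have e: "e \<in> parcs (commuting_graph S m)" "u = fst e" "awalk (snd e) p w"
      by (auto simp: awalk_Cons_iff)
    then have "P (snd e)"
      using closed[of u "snd e"] Cons.prems(2) by (auto simp: commuting_graph_def)
    with Cons.IH e(3) show ?case by blast
  qed
  then have "{p. apath a p b} = {}"
    using assms(2,3) awalkI_apath by blast
  then show ?thesis by (simp add: distance_def top_enat_def)
qed

lemma distance_le_diameter:
  "u \<in> pverts G \<Longrightarrow> v \<in> pverts G \<Longrightarrow> distance G u v \<le> diameter G"
  unfolding diameter_def by (rule SUP_upper2[of "(u, v)"]) auto

section \<open>Vertices of the commuting graph\<close>

lemma finite_sym_inv:
  assumes "finite X"
  shows "finite (sym_inv X)"
proof (rule finite_subset)
  show "sym_inv X \<subseteq> (\<Union>A\<in>Pow X. {f. dom f = A \<and> ran f \<subseteq> X})"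
    by (auto simp: sym_inv_def)
  show "finite (\<Union>A\<in>Pow X. {f :: 'a \<rightharpoonup> 'a. dom f = A \<and> ran f \<subseteq> X})"
    using assms by (auto intro!: finite_set_of_finite_maps dest: finite_subset)
qed

lemma sym_invD:
  assumes "f \<in> sym_inv X" "f x = Some y"
  shows "x \<in> X" "y \<in> X"
  using assms by (auto simp: sym_inv_def ran_def)

lemma sym_inv_inj:
  assumes "f \<in> sym_inv X" "f x = Some z" "f y = Some z"
  shows "x = y"
  using assms by (auto simp: sym_inv_def dest: inj_onD[of f "dom f" x y])

lemma sym_invI:
  assumes "\<And>x y. f x = Some y \<Longrightarrow> x \<in> X \<and> y \<in> X"
    and "\<And>x y z. f x = Some z \<Longrightarrow> f y = Some z \<Longrightarrow> x = y"
  shows "f \<in> sym_inv X"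
  unfolding sym_inv_def
proof (intro CollectI conjI inj_onI)
  show "dom f \<subseteq> X" "ran f \<subseteq> X" using assms(1) by (auto simp: ran_def)
  show "x = y" if "x \<in> dom f" "y \<in> dom f" "f x = f y" for x y
    using that assms(2)[of x _ y] by auto
qed

lemma partial_identity_in_sym_inv: "A \<subseteq> X \<Longrightarrow> Some |` A \<in> sym_inv X"
  by (rule sym_invI) (auto simp: restrict_map_def split: if_splits)

lemma center_sym_inv:
  "semigroup_center (sym_inv X) (\<circ>\<^sub>m) = {Map.empty, Some |` X}"
proof (intro equalityI subsetI)
  fix a assume "a \<in> semigroup_center (sym_inv X) (\<circ>\<^sub>m)"
  then have a: "a \<in> sym_inv X" and comm: "\<And>b. b \<in> sym_inv X \<Longrightarrow> a \<circ>\<^sub>m b = b \<circ>\<^sub>m a"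
    by (auto simp: semigroup_center_def)
  show "a \<in> {Map.empty, Some |` X}"
  proof (cases "a = Map.empty")
    case False
    then obtain x y where xy: "a x = Some y" by fastforce
    note X = sym_invD[OF a xy]
    \<comment> \<open>Commuting with the identity on a single point of its domain makes
      \<open>a\<close> fix that point; the one-point maps \<open>[x \<mapsto> z]\<close> then carry
      this to every \<open>z\<close> in \<open>X\<close>.\<close>
    have "a \<circ>\<^sub>m (Some |` {x}) = (Some |` {x}) \<circ>\<^sub>m a"
      using X by (intro comm partial_identity_in_sym_inv) auto
    from fun_cong[OF this, of x] xy have "y = x"
      by (auto simp: map_comp_def restrict_map_def split: if_splits)
    have "a z = Some z" if "z \<in> X" for z
    proof -
      have "[x \<mapsto> z] \<in> sym_inv X"
        using X that by (intro sym_invI) (auto split: if_splits)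
      from fun_cong[OF comm[OF this], of x] xy \<open>y = x\<close> show ?thesis
        by (auto simp: map_comp_def)
    qed
    moreover have "a z = None" if "z \<notin> X" for z
      using a that by (auto simp: sym_inv_def)
    ultimately have "a = Some |` X" by (auto simp: restrict_map_def)
    then show ?thesis by simp
  qed simp
next
  fix a assume "a \<in> {Map.empty, Some |` X}"
  moreover have "Map.empty \<circ>\<^sub>m b = b \<circ>\<^sub>m Map.empty" for b :: "'a \<rightharpoonup> 'a"
    by (auto simp: map_comp_def split: option.splits)
  moreover have "(Some |` X) \<circ>\<^sub>m b = b \<circ>\<^sub>m (Some |` X)" if "b \<in> sym_inv X" for b
  proof
    fix x show "((Some |` X) \<circ>\<^sub>m b) x = (b \<circ>\<^sub>m (Some |` X)) x"
      using sym_invD[OF that, of x]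
      by (cases "b x") (auto simp: map_comp_def restrict_map_def)
  qed
  moreover have "Map.empty \<in> sym_inv X" by (rule sym_invI) auto
  ultimately show "a \<in> semigroup_center (sym_inv X) (\<circ>\<^sub>m)"
    by (auto simp: semigroup_center_def partial_identity_in_sym_inv)
qed

lemma partial_identity_vertex:
  assumes "A \<subset> X" "A \<noteq> {}"
  shows "Some |` A \<in> sym_inv X - {Map.empty, Some |` X}"
proof -
  have "dom (Some |` A) = A" "dom (Some |` X) = X" by auto
  with assms show ?thesis using partial_identity_in_sym_inv[of A X]
    by (metis DiffI dom_empty insertE psubset_eq singletonD)
qed

section \<open>Full cycles and full chains\<close>

text \<open>The bijection \<open>h\<close> numbers the points of \<open>X\<close> along the cycle or the chain.\<close>

definition full_cycle :: "'a set \<Rightarrow> (nat \<Rightarrow> 'a) \<Rightarrow> ('a \<rightharpoonup> 'a) \<Rightarrow> bool" where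
  "full_cycle X h c \<longleftrightarrow> bij_betw h {..<card X} X \<and>
    (\<forall>i<card X. c (h i) = Some (h (Suc i mod card X)))"

definition full_chain :: "'a set \<Rightarrow> (nat \<Rightarrow> 'a) \<Rightarrow> ('a \<rightharpoonup> 'a) \<Rightarrow> bool" where
  "full_chain X h f \<longleftrightarrow> bij_betw h {..<card X} X \<and>
    (\<forall>i<card X. f (h i) = (if Suc i < card X then Some (h (Suc i)) else None))"

text \<open>Conjugation by \<open>h\<close> turns a partial injection of the indices into one of
  \<open>X\<close>; this produces both the cycle and the chain.\<close>

lemma transported_map_exists:
  assumes "bij_betw h {..<n} X"
    and \<phi>: "\<And>i j. i < n \<Longrightarrow> \<phi> i = Some j \<Longrightarrow> j < n"
    and inj: "\<And>i i' j. i < n \<Longrightarrow> i' < n \<Longrightarrow> \<phi> i = Some j \<Longrightarrow> \<phi> i' = Some j \<Longrightarrow> i = i'"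
  shows "\<exists>f\<in>sym_inv X. \<forall>i<n. f (h i) = map_option h (\<phi> i)"
proof -
  define g where "g = the_inv_into {..<n} h"
  have h: "inj_on h {..<n}" "h ` {..<n} = X" using assms(1) by (auto simp: bij_betw_def)
  have g: "g (h i) = i" if "i < n" for i
    using that h(1) by (simp add: g_def the_inv_into_f_f)
  define f where "f = (\<lambda>x. if x \<in> X then map_option h (\<phi> (g x)) else None)"
  have f: "f (h i) = map_option h (\<phi> i)" if "i < n" for i
    using that h(2) g by (auto simp: f_def)
  have X: "\<exists>i<n. x = h i" if "x \<in> X" for x using that h(2) by auto
  have fX: "x \<in> X" if "f x = Some y" for x y using that by (auto simp: f_def split: if_splits)
  have "f \<in> sym_inv X"
  proof (rule sym_invI)
    fix x y assume xy: "f x = Some y"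
    from X[OF fX[OF xy]] obtain i where i: "i < n" "x = h i" by blast
    with xy f obtain j where "\<phi> i = Some j" "y = h j" by auto
    with \<phi>[OF i(1)] h(2) fX[OF xy] show "x \<in> X \<and> y \<in> X" by auto
  next
    fix x y z assume xz: "f x = Some z" and yz: "f y = Some z"
    from X[OF fX[OF xz]] obtain i where i: "i < n" "x = h i" by blast
    from X[OF fX[OF yz]] obtain i' where i': "i' < n" "y = h i'" by blast
    from i xz f obtain j where j: "\<phi> i = Some j" "z = h j" by auto
    from i' yz f obtain j' where j': "\<phi> i' = Some j'" "z = h j'" by auto
    have "j = j'" using j j' \<phi>[OF i(1) j(1)] \<phi>[OF i'(1) j'(1)] h(1) by (auto dest: inj_onD)
    with inj i i' j j' show "x = y" by blast
  qed
  with f show ?thesis by blast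
qed

lemma full_cycle_exists:
  assumes "bij_betw h {..<card X} X"
  shows "\<exists>c\<in>sym_inv X. full_cycle X h c"
proof -
  have "\<exists>c\<in>sym_inv X. \<forall>i<card X. c (h i) = map_option h (Some (Suc i mod card X))"
    by (rule transported_map_exists[OF assms]) (auto simp: mod_Suc split: if_splits)
  with assms show ?thesis by (auto simp: full_cycle_def)
qed

lemma full_chain_exists:
  assumes "bij_betw h {..<card X} X"
  shows "\<exists>f\<in>sym_inv X. full_chain X h f"
proof -
  have "\<exists>f\<in>sym_inv X. \<forall>i<card X. f (h i) =
      map_option h (if Suc i < card X then Some (Suc i) else None)"
    by (rule transported_map_exists[OF assms]) (auto split: if_splits)
  then obtain f where "f \<in> sym_inv X" "\<forall>i<card X. f (h i) =
      map_option h (if Suc i < card X then Some (Suc i) else None)" by blast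
  with assms show ?thesis by (intro bexI[of _ f]) (auto simp: full_chain_def)
qed

section \<open>Centralizers of full cycles and full chains\<close>

lemma sym_inv_eqI:
  assumes "f \<in> sym_inv X" "g \<in> sym_inv X" "bij_betw h {..<n} X" "\<And>i. i < n \<Longrightarrow> f (h i) = g (h i)"
  shows "f = g"
proof
  fix x show "f x = g x"
  proof (cases "x \<in> X")
    case True
    then show ?thesis using assms(3,4) by (auto simp: bij_betw_def)
  next
    case False
    then have "f x = None" "g x = None" using assms(1,2) by (auto simp: sym_inv_def)
    then show ?thesis by simp
  qed
qed

text \<open>Commutation propagates the value of \<open>y\<close> at \<open>h 0\<close> along the
  cycle. If it is undefined, \<open>y\<close> is empty; if it is \<open>h j\<close>, then
  \<open>y\<close> is the \<open>j\<close>-th power of \<open>c\<close>, and \<open>j = 0\<close>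
  gives the identity.\<close>

lemma full_cycle_centralizer:
  assumes "full_cycle X h c" "y \<in> sym_inv X - {Map.empty, Some |` X}" "c \<circ>\<^sub>m y = y \<circ>\<^sub>m c"
  shows "\<exists>j. 0 < j \<and> j < card X \<and> (\<forall>i<card X. y (h i) = Some (h ((i + j) mod card X)))"
proof -
  let ?n = "card X"
  have h: "bij_betw h {..<?n} X" and c: "\<And>i. i < ?n \<Longrightarrow> c (h i) = Some (h (Suc i mod ?n))"
    using assms(1) by (auto simp: full_cycle_def)
  have y: "y \<in> sym_inv X" "y \<noteq> Map.empty" "y \<noteq> Some |` X" using assms(2) by auto
  have rX: "\<exists>i<?n. x = h i" if "x \<in> X" for x using that h by (auto simp: bij_betw_def)
  have hX: "h i \<in> X" if "i < ?n" for i using that h by (auto simp: bij_betw_def)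
  have step: "y (h (Suc i)) = (case y (h i) of None \<Rightarrow> None | Some z \<Rightarrow> c z)" if "Suc i < ?n" for i
    using fun_cong[OF assms(3), of "h i"] c[of i] that
    by (auto simp: map_comp_def split: option.splits)
  have "y (h 0) \<noteq> None"
  proof
    assume 0: "y (h 0) = None"
    have None: "y (h i) = None" if "i < ?n" for i
      using that by (induction i) (auto simp: 0 step)
    have "y = Map.empty"
      using y(1) _ h
    proof (rule sym_inv_eqI)
      show "Map.empty \<in> sym_inv X" by (rule sym_invI) auto
    qed (simp add: None)
    with y show False by simp
  qed
  then obtain z where z: "y (h 0) = Some z" by auto
  with rX sym_invD[OF y(1) z] obtain j where j: "j < ?n" "z = h j" by blast
  have shift: "y (h i) = Some (h ((i + j) mod ?n))" if "i < ?n" for i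
    using that
  proof (induction i)
    case 0
    then show ?case using z j by simp
  next
    case (Suc i)
    then show ?case using step[of i] c[of "(i + j) mod ?n"] j by (simp add: mod_Suc_eq)
  qed
  have "j \<noteq> 0"
  proof
    assume "j = 0"
    then have "y = Some |` X"
      using shift hX by (intro sym_inv_eqI[OF y(1) _ h]) (auto simp: partial_identity_in_sym_inv)
    with y show False by simp
  qed
  with j shift show ?thesis by auto
qed

text \<open>As for the cycle, the value at \<open>h 0\<close> determines \<open>x\<close>, but the
  resulting shift by \<open>k\<close> is cut off at the end of the chain.\<close>

lemma full_chain_centralizer:
  assumes "full_chain X h f" "x \<in> sym_inv X - {Map.empty, Some |` X}" "f \<circ>\<^sub>m x = x \<circ>\<^sub>m f"
  shows "\<exists>k. 0 < k \<and> k < card X \<and>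
    (\<forall>i<card X. x (h i) = (if i + k < card X then Some (h (i + k)) else None))"
proof -
  let ?n = "card X"
  have h: "bij_betw h {..<?n} X"
    and f: "\<And>i. i < ?n \<Longrightarrow> f (h i) = (if Suc i < card X then Some (h (Suc i)) else None)"
    using assms(1) by (auto simp: full_chain_def)
  have x: "x \<in> sym_inv X" "x \<noteq> Map.empty" "x \<noteq> Some |` X" using assms(2) by auto
  have rX: "\<exists>i<?n. x = h i" if "x \<in> X" for x using that h by (auto simp: bij_betw_def)
  have hX: "h i \<in> X" if "i < ?n" for i using that h by (auto simp: bij_betw_def)
  have step: "x (h (Suc i)) = (case x (h i) of None \<Rightarrow> None | Some z \<Rightarrow> f z)" if "Suc i < ?n" for i
    using fun_cong[OF assms(3), of "h i"] f[of i] that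
    by (auto simp: map_comp_def split: option.splits)
  have "x (h 0) \<noteq> None"
  proof
    assume 0: "x (h 0) = None"
    have None: "x (h i) = None" if "i < ?n" for i
      using that by (induction i) (auto simp: 0 step)
    have "x = Map.empty"
      using x(1) _ h
    proof (rule sym_inv_eqI)
      show "Map.empty \<in> sym_inv X" by (rule sym_invI) auto
    qed (simp add: None)
    with x show False by simp
  qed
  then obtain z where z: "x (h 0) = Some z" by auto
  with rX sym_invD[OF x(1) z] obtain k where k: "k < ?n" "z = h k" by blast
  have shift: "x (h i) = (if i + k < ?n then Some (h (i + k)) else None)" if "i < ?n" for i
    using that
  proof (induction i)
    case 0
    then show ?case using z k by simp
  next
    case (Suc i)
    then show ?case using step[of i] f[of "i + k"] by auto
  qed
  have "k \<noteq> 0"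
  proof
    assume "k = 0"
    then have "x = Some |` X"
      using shift hX by (intro sym_inv_eqI[OF x(1) _ h]) (auto simp: partial_identity_in_sym_inv)
    with x show False by simp
  qed
  with k shift show ?thesis by auto
qed

text \<open>
  If a power of the chain commutes with a power of the cycle, then its domain, an initial segment
  of \<open>0, \<dots>, n - 1\<close>, is invariant under a shift modulo \<open>n\<close>; the images of \<open>0\<close> and \<open>n - 1\<close> under
  the shift are consecutive in the wrong order.
\<close>

lemma chain_cycle_centralizers_not_commute:
  assumes "full_chain X h f" "full_cycle X h c"
    and "x \<in> sym_inv X - {Map.empty, Some |` X}" "f \<circ>\<^sub>m x = x \<circ>\<^sub>m f"
    and "y \<in> sym_inv X - {Map.empty, Some |` X}" "c \<circ>\<^sub>m y = y \<circ>\<^sub>m c"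
  shows "x \<circ>\<^sub>m y \<noteq> y \<circ>\<^sub>m x"
proof
  assume xy: "x \<circ>\<^sub>m y = y \<circ>\<^sub>m x"
  let ?n = "card X"
  from full_chain_centralizer[OF assms(1,3,4)] obtain k where k: "0 < k" "k < ?n"
    and x: "\<And>i. i < ?n \<Longrightarrow> x (h i) = (if i + k < ?n then Some (h (i + k)) else None)" by blast
  from full_cycle_centralizer[OF assms(2,5,6)] obtain j where j: "0 < j" "j < ?n"
    and y: "\<And>i. i < ?n \<Longrightarrow> y (h i) = Some (h ((i + j) mod ?n))" by blast
  \<comment> \<open>At \<open>h 0\<close> the product with \<open>x\<close> applied first is
    defined, since \<open>y\<close> is total on \<open>X\<close>; hence \<open>x\<close> must be
    defined at \<open>h j\<close>.\<close>
  have "j + k < ?n"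
    using fun_cong[OF xy, of "h 0"] x[of 0] x[of j] y[of 0] y[of k] k j
    by (auto simp: map_comp_def split: if_splits)
  moreover have "(?n - 1 + j) mod ?n = j - 1"
  proof -
    have "?n - 1 + j = (j - 1) + ?n" using j by simp
    then show ?thesis using j by (simp del: add_diff_assoc2)
  qed
  \<comment> \<open>At \<open>h (?n - 1)\<close> the map \<open>x\<close> is undefined because
    \<open>0 < k\<close>, so it is also undefined at the image \<open>h (j - 1)\<close> of this
    point under \<open>y\<close>.\<close>
  then have "\<not> j - 1 + k < ?n"
    using fun_cong[OF xy, of "h (?n - 1)"] x[of "?n - 1"] x[of "j - 1"] y[of "?n - 1"] k j
    by (auto simp: map_comp_def split: if_splits)
  ultimately show False by linarith
qed

text \<open>The neighbour is a shift by some \<open>j\<close> coprime to the prime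
  \<open>card X\<close>. Renumbering the points in steps of \<open>j\<close> turns it into the
  successor map, which is why the numbering \<open>h'\<close> may differ from
  \<open>h\<close>.\<close>

lemma full_cycle_neighbour_prime:
  assumes "prime (card X)" "full_cycle X h c"
    and "y \<in> sym_inv X - {Map.empty, Some |` X}" "c \<circ>\<^sub>m y = y \<circ>\<^sub>m c"
  shows "\<exists>h'. full_cycle X h' y"
proof -
  let ?n = "card X"
  from full_cycle_centralizer[OF assms(2-4)] obtain j where j: "0 < j" "j < ?n"
    and y: "\<And>i. i < ?n \<Longrightarrow> y (h i) = Some (h ((i + j) mod ?n))" by blast
  have h: "bij_betw h {..<?n} X" using assms(2) by (simp add: full_cycle_def)
  have "coprime ?n j" using assms(1) j
    by (meson nat_dvd_not_less prime_imp_coprime)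
  have "inj_on (\<lambda>i. i * j mod ?n) {..<?n}"
  proof -
    have *: "a = b" if "a * j mod ?n = b * j mod ?n" "a < ?n" "b < ?n" "a \<le> b" for a b
    proof -
      have "?n dvd b * j - a * j" using that(1,4) by (metis mod_eq_dvd_iff_nat mult_le_mono1)
      then have "?n dvd (b - a) * j" by (simp add: diff_mult_distrib)
      with \<open>coprime ?n j\<close> have "?n dvd b - a" by (simp add: coprime_dvd_mult_left_iff)
      with that show ?thesis using nat_dvd_not_less[of "b - a" ?n] by fastforce
    qed
    then show ?thesis unfolding inj_on_def by (metis lessThan_iff nat_le_linear)
  qed
  moreover have "(\<lambda>i. i * j mod ?n) ` {..<?n} \<subseteq> {..<?n}" using j by auto
  ultimately have "bij_betw (\<lambda>i. i * j mod ?n) {..<?n} {..<?n}"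
    by (simp add: bij_betw_def endo_inj_surj)
  then have "bij_betw (h \<circ> (\<lambda>i. i * j mod ?n)) {..<?n} X"
    using h by (rule bij_betw_trans)
  moreover have "y (h (i * j mod ?n)) = Some (h ((Suc i mod ?n) * j mod ?n))" for i
    using y[of "i * j mod ?n"] j
    by (metis add.commute mod_add_left_eq mod_less_divisor mod_mult_left_eq mult_Suc order.strict_trans)
  ultimately have "full_cycle X (h \<circ> (\<lambda>i. i * j mod ?n)) y" by (simp add: full_cycle_def)
  then show ?thesis by blast
qed

section \<open>Neighbours commuting with a proper idempotent\<close>

text \<open>The equivalence makes \<open>A\<close> closed under images and preimages, that is, a
  union of components of \<open>f\<close>. Closure under images alone would not give commutation
  with the identity on \<open>A\<close>.\<close>

definition invariant :: "('a \<rightharpoonup> 'a) \<Rightarrow> 'a set \<Rightarrow> bool" where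
  "invariant f A \<longleftrightarrow> (\<forall>x y. f x = Some y \<longrightarrow> (x \<in> A \<longleftrightarrow> y \<in> A))"

lemma invariant_commute:
  assumes "invariant f A"
  shows "f \<circ>\<^sub>m (Some |` A) = (Some |` A) \<circ>\<^sub>m f"
proof
  fix x show "(f \<circ>\<^sub>m (Some |` A)) x = ((Some |` A) \<circ>\<^sub>m f) x"
    using assms by (cases "f x") (auto simp: invariant_def map_comp_def restrict_map_def)
qed

text \<open>The forward orbit of \<open>x\<close> is closed under preimages too: \<open>x\<close>
  has none, and by injectivity every later point has only its predecessor in the orbit.\<close>

lemma invariant_from_source:
  assumes "f \<in> sym_inv X" "x \<notin> ran f"
  shows "invariant f {y. (x, y) \<in> (Map.graph f)\<^sup>*}"
  unfolding invariant_def
proof (intro allI impI iffI; clarify)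
  fix y z assume yz: "f y = Some z"
  { assume "(x, y) \<in> (Map.graph f)\<^sup>*"
    with yz show "(x, z) \<in> (Map.graph f)\<^sup>*" by (meson in_graphI rtrancl.rtrancl_into_rtrancl) }
  { assume "(x, z) \<in> (Map.graph f)\<^sup>*"
    then show "(x, y) \<in> (Map.graph f)\<^sup>*"
    proof (cases rule: rtranclE)
      case base
      with yz assms(2) show ?thesis by (auto simp: ran_def)
    next
      case (step w)
      then have "w = y" using sym_inv_inj[OF assms(1) _ yz] by (auto dest: in_graphD)
      with step show ?thesis by simp
    qed }
qed

lemma reach_subset:
  assumes "f \<in> sym_inv X" "x \<in> X"
  shows "{y. (x, y) \<in> (Map.graph f)\<^sup>*} \<subseteq> X"
proof clarify
  fix y assume "(x, y) \<in> (Map.graph f)\<^sup>*"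
  then show "y \<in> X" using assms
    by (induction rule: rtrancl_induct) (auto dest!: in_graphD dest: sym_invD)
qed

text \<open>
  Without a proper invariant set, a map with a point outside its range is a chain through all of
  \<open>X\<close>; the points at even distance from the start are then invariant under the square of the map.
\<close>

lemma source_idempotent_neighbour:
  assumes "card X \<ge> 3" "f \<in> sym_inv X" "f \<noteq> Map.empty" "x \<in> X" "x \<notin> ran f"
  shows "\<exists>g A. g \<in> sym_inv X - {Map.empty, Some |` X} \<and> f \<circ>\<^sub>m g = g \<circ>\<^sub>m f \<and>
    invariant g A \<and> A \<subset> X \<and> A \<noteq> {}"
proof -
  have fX: "f \<noteq> Some |` X" using assms(4,5) by (metis ranI restrict_in)
  let ?A = "{y. (x, y) \<in> (Map.graph f)\<^sup>*}"
  show ?thesis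
  proof (cases "?A = X")
    case False
    \<comment> \<open>Here \<open>f\<close> serves as its own neighbour \<open>g\<close>.\<close>
    then have "?A \<subset> X" using reach_subset[OF assms(2,4)] by blast
    moreover have "x \<in> ?A" by simp
    ultimately show ?thesis using assms(2,3) fX invariant_from_source[OF assms(2,5)]
      by (intro exI[of _ f] exI[of _ ?A]) auto
  next
    case True
    let ?g = "f \<circ>\<^sub>m f"
    let ?B = "{y. (x, y) \<in> (Map.graph ?g)\<^sup>*}"
    have g: "?g \<in> sym_inv X" using assms(2) by (simp add: map_comp_in_sym_inv)
    have xg: "x \<notin> ran ?g" using assms(5) by (auto simp: ran_def map_comp_Some_iff)
    \<comment> \<open>With at least three points on the chain, two steps from \<open>x\<close> are
      possible, so the square of \<open>f\<close> is not empty.\<close>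
    have small: "card Y < 3" if "finite Y" "Y \<subseteq> {a, b}" for Y :: "'a set" and a b
      using card_mono[OF _ that(2)] by (simp add: card_insert_if split: if_splits)
    have reach: "?A \<subseteq> Y" if "x \<in> Y" "\<And>y z. y \<in> Y \<Longrightarrow> f y = Some z \<Longrightarrow> z \<in> Y" for Y
    proof clarify
      fix y assume "(x, y) \<in> (Map.graph f)\<^sup>*"
      then show "y \<in> Y"
        by (induction rule: rtrancl_induct) (auto dest!: in_graphD intro: that)
    qed
    have fin: "finite X" using assms(1) by (metis card.infinite not_numeral_le_zero)
    have "f x \<noteq> None"
    proof
      assume "f x = None"
      then have "X \<subseteq> {x, x}" using reach[of "{x}"] True by auto
      with small[OF fin] assms(1) show False by fastforce
    qed
    then obtain y where y: "f x = Some y" by auto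
    have "f y \<noteq> None"
    proof
      assume "f y = None"
      then have "?A \<subseteq> {x, y}" using y by (intro reach) auto
      then have "X \<subseteq> {x, y}" unfolding True .
      with small[OF fin] assms(1) show False by fastforce
    qed
    then obtain z where z: "f y = Some z" by auto
    have "?g x = Some z" using y z by simp
    then have "?g \<noteq> Map.empty" by (metis option.distinct(1))
    moreover have "?g \<noteq> Some |` X" using assms(4) xg by (metis ranI restrict_in)
    \<comment> \<open>The second point \<open>y\<close> of the chain witnesses that
      \<open>?B\<close> is proper: its only preimage under \<open>f\<close> is \<open>x\<close>,
      which has none, so the square does not reach \<open>y\<close>.\<close>
    moreover have "y \<notin> ?B"
    proof
      assume "y \<in> ?B"
      then have "(x, y) \<in> (Map.graph ?g)\<^sup>*" by simp
      then show False
      proof (cases rule: rtranclE)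
        case base
        with y assms(5) show ?thesis by (auto simp: ran_def)
      next
        case (step w)
        then obtain v where v: "f w = Some v" "f v = Some y"
          by (auto dest!: in_graphD simp: map_comp_Some_iff)
        then have "v = x" using sym_inv_inj[OF assms(2)] y by blast
        with v assms(5) show ?thesis by (auto simp: ran_def)
      qed
    qed
    then have "?B \<subset> X" using reach_subset[OF g assms(4)] sym_invD(2)[OF assms(2) y] by blast
    moreover have "x \<in> ?B" by simp
    moreover have "f \<circ>\<^sub>m ?g = ?g \<circ>\<^sub>m f" by (auto simp: map_comp_def split: option.splits)
    ultimately show ?thesis using g invariant_from_source[OF g xg]
      by (intro exI[of _ ?g] exI[of _ ?B]) blast
  qed
qed

section \<open>Permutations\<close>

lemma permutation_map_in_sym_inv:
  assumes "\<pi> permutes X"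
  shows "(Some \<circ> \<pi>) |` X \<in> sym_inv X"
  by (rule sym_invI)
    (auto simp: restrict_map_def permutes_in_image[OF assms] split: if_splits
      dest: injD[OF permutes_inj[OF assms]])

text \<open>By finiteness an injection of \<open>A\<close> into itself is onto, so closure under
  images already gives closure under preimages.\<close>

lemma permutation_map_invariant:
  assumes "finite A" "\<pi> permutes X" "\<pi> ` A \<subseteq> A"
  shows "invariant ((Some \<circ> \<pi>) |` X) A"
proof -
  have "inj \<pi>" using assms(2) by (rule permutes_inj)
  then have "\<pi> ` A = A" using assms(1,3) by (meson endo_inj_surj inj_on_subset subset_UNIV)
  then have "\<pi> x \<in> A \<longleftrightarrow> x \<in> A" for x using \<open>inj \<pi>\<close> by (metis inj_image_mem_iff)
  then show ?thesis by (auto simp: invariant_def restrict_map_def split: if_splits)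
qed

lemma funpow_orbit_eq:
  assumes "(\<pi> ^^ k) x = x" "0 < k"
  shows "range (\<lambda>i. (\<pi> ^^ i) x) = (\<lambda>i. (\<pi> ^^ i) x) ` {..<k}"
proof -
  have "(\<pi> ^^ i) x \<in> (\<lambda>i. (\<pi> ^^ i) x) ` {..<k}" for i
    using funpow_mod_eq[OF assms(1), of i] assms(2) by (intro image_eqI[of _ _ "i mod k"]) auto
  then show ?thesis by blast
qed

text \<open>
  Without a proper invariant set, a permutation is an \<open>n\<close>-cycle; its power by a proper divisor of
  \<open>n\<close> is not transitive.
\<close>

lemma permutation_idempotent_neighbour:
  assumes "finite X" "card X \<ge> 2" "\<not> prime (card X)" "\<pi> permutes X" "\<pi> \<noteq> id"
  shows "\<exists>g A. g \<in> sym_inv X - {Map.empty, Some |` X} \<and>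
    ((Some \<circ> \<pi>) |` X) \<circ>\<^sub>m g = g \<circ>\<^sub>m ((Some \<circ> \<pi>) |` X) \<and> invariant g A \<and> A \<subset> X \<and> A \<noteq> {}"
proof -
  let ?n = "card X"
  have nonempty: "(Some \<circ> \<sigma>) |` X \<noteq> Map.empty" for \<sigma> :: "'a \<Rightarrow> 'a"
  proof -
    have "dom ((Some \<circ> \<sigma>) |` X) = X" by auto
    moreover have "X \<noteq> {}" using assms(2) by auto
    ultimately show ?thesis by (metis dom_empty)
  qed
  have nonid: "(Some \<circ> \<sigma>) |` X \<noteq> Some |` X" if "x \<in> X" "\<sigma> x \<noteq> x" for \<sigma> :: "'a \<Rightarrow> 'a" and x
    using that by (auto dest!: fun_cong[of _ _ x])
  obtain x0 where x0: "x0 \<in> X" "\<pi> x0 \<noteq> x0"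
    using assms(4,5) by (metis eq_id_iff permutes_not_in)
  let ?A = "range (\<lambda>i. (\<pi> ^^ i) x0)"
  have pow: "(\<pi> ^^ i) permutes X" for i using assms(4) by (rule permutes_funpow)
  have AX: "(\<pi> ^^ i) x0 \<in> X" for i using x0 permutes_in_image[OF pow] by blast
  show ?thesis
  proof (cases "?A = X")
    case False
    have "\<pi> ((\<pi> ^^ i) x0) = (\<pi> ^^ Suc i) x0" for i by simp
    then have "\<pi> ` ?A \<subseteq> ?A" by blast
    moreover have "?A \<subset> X" using AX False by blast
    ultimately have "invariant ((Some \<circ> \<pi>) |` X) ?A"
      using assms(1,4) by (meson finite_subset permutation_map_invariant psubsetE)
    with \<open>?A \<subset> X\<close> nonempty[of \<pi>] nonid[of x0 \<pi>, OF x0] permutation_map_in_sym_inv[OF assms(4)] show ?thesis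
      by (intro exI[of _ "(Some \<circ> \<pi>) |` X"] exI[of _ ?A]) auto
  next
    case True
    \<comment> \<open>The least period of \<open>x0\<close> is the size of its orbit, because
      \<open>support\<close> lists the orbit without repetition; the orbit being \<open>X\<close>,
      the period is \<open>?n\<close>.\<close>
    let ?k = "least_power \<pi> x0"
    have perm: "permutation \<pi>" using assms(1,4) by (rule permutes_imp_permutation)
    note k = least_power_of_permutation[OF perm, of x0]
    have "distinct (support \<pi> x0)" using perm by (rule cycle_of_permutation)
    then have "card (set (support \<pi> x0)) = length (support \<pi> x0)" by (rule distinct_card)
    moreover have "set (support \<pi> x0) = X" using funpow_orbit_eq[OF k] True by (simp add: atLeast0LessThan)
    ultimately have kn: "?k = ?n" by simp
    obtain p where p: "p dvd ?n" "p \<noteq> 1" "p \<noteq> ?n"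
      using assms(2,3) by (auto simp: prime_nat_iff)
    then obtain q where q: "?n = p * q" by blast
    have pos: "0 < p" "0 < q" using q assms(2) by (auto intro: Nat.gr0I)
    moreover have "p < ?n" using p assms(2) by (simp add: dvd_imp_le le_neq_implies_less)
    moreover have "q < ?n" using pos p(2) q by simp
    ultimately have pq: "0 < p" "0 < q" "p < ?n" "q < ?n" by blast+
    let ?\<sigma> = "\<pi> ^^ p"
    let ?B = "range (\<lambda>i. (?\<sigma> ^^ i) x0)"
    \<comment> \<open>The exponent \<open>p\<close> is positive and below the least period
      \<open>?n\<close>, so the power is not the identity; its orbit \<open>?B\<close> closes up
      after \<open>q < ?n\<close> steps and is therefore proper.\<close>
    have "?\<sigma> x0 \<noteq> x0"
      using least_power_le[of p \<pi> x0] pq kn by auto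
    have "(?\<sigma> ^^ q) x0 = x0" using k(1) kn q by (simp add: funpow_mult mult.commute)
    from funpow_orbit_eq[OF this pq(2)] have "card ?B \<le> q"
      by (metis card_image_le card_lessThan finite_lessThan)
    moreover have "?B \<subseteq> X" using permutes_in_image[OF permutes_funpow[OF pow]] x0(1) by blast
    ultimately have "?B \<subset> X" using pq by auto
    have "?\<sigma> ((?\<sigma> ^^ i) x0) = (?\<sigma> ^^ Suc i) x0" for i by simp
    then have "?\<sigma> ` ?B \<subseteq> ?B" by blast
    with \<open>?B \<subset> X\<close> have "invariant ((Some \<circ> ?\<sigma>) |` X) ?B"
      using assms(1) pow by (meson finite_subset permutation_map_invariant psubsetE)
    moreover have "((Some \<circ> \<pi>) |` X) \<circ>\<^sub>m ((Some \<circ> ?\<sigma>) |` X) = ((Some \<circ> ?\<sigma>) |` X) \<circ>\<^sub>m ((Some \<circ> \<pi>) |` X)"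
      using permutes_in_image[OF assms(4)] permutes_in_image[OF pow]
      by (auto simp: fun_eq_iff map_comp_def restrict_map_def funpow_swap1)
    ultimately show ?thesis
      using \<open>?B \<subset> X\<close> nonempty[of ?\<sigma>] nonid[of x0 ?\<sigma>, OF x0(1) \<open>?\<sigma> x0 \<noteq> x0\<close>] permutation_map_in_sym_inv[OF pow]
      by (intro exI[of _ "(Some \<circ> ?\<sigma>) |` X"] exI[of _ ?B]) auto
  qed
qed

text \<open>The domain lies in \<open>X\<close> and has an image covering \<open>X\<close>, so by
  finiteness it is all of \<open>X\<close>.\<close>

lemma total_map_is_permutation:
  assumes "finite X" "f \<in> sym_inv X" "X \<subseteq> ran f"
  shows "\<exists>\<pi>. \<pi> permutes X \<and> f = (Some \<circ> \<pi>) |` X"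
proof -
  \<comment> \<open>The default value \<open>x\<close> fixes the points outside \<open>X\<close>, as
    \<open>permutes\<close> demands.\<close>
  let ?\<pi> = "\<lambda>x. case f x of None \<Rightarrow> x | Some y \<Rightarrow> y"
  have "X \<subseteq> (the \<circ> f) ` dom f"
    using assms(3) by (force simp: ran_def)
  moreover have "dom f \<subseteq> X" using assms(2) by (simp add: sym_inv_def)
  ultimately have "dom f = X"
    using assms(1) by (metis card_image_le card_mono card_seteq finite_imageI finite_subset order_trans)
  have "bij_betw ?\<pi> X X"
  proof -
    have "inj_on ?\<pi> X"
      using \<open>dom f = X\<close> sym_inv_inj[OF assms(2)] by (auto simp: inj_on_def split: option.splits)
    moreover have "?\<pi> ` X \<subseteq> X"
      using sym_invD[OF assms(2)] by (auto split: option.splits)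
    ultimately show ?thesis using assms(1) by (simp add: bij_betw_def endo_inj_surj)
  qed
  then have "?\<pi> permutes X"
    using \<open>dom f = X\<close> by (intro bij_imp_permutes) (auto split: option.splits)
  moreover have "f = (Some \<circ> ?\<pi>) |` X"
    using \<open>dom f = X\<close> by (auto simp: fun_eq_iff restrict_map_def split: option.splits)
  ultimately show ?thesis by blast
qed

lemma idempotent_neighbour:
  assumes "finite X" "card X \<ge> 3" "\<not> prime (card X)" "f \<in> sym_inv X - {Map.empty, Some |` X}"
  shows "\<exists>g A. g \<in> sym_inv X - {Map.empty, Some |` X} \<and> f \<circ>\<^sub>m g = g \<circ>\<^sub>m f \<and>
    invariant g A \<and> A \<subset> X \<and> A \<noteq> {}"
proof (cases "X \<subseteq> ran f")
  case True
  with total_map_is_permutation[OF assms(1)] assms(4) obtain \<pi>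
    where \<pi>: "\<pi> permutes X" "f = (Some \<circ> \<pi>) |` X" by blast
  with assms(4) have "\<pi> \<noteq> id" by auto
  then show ?thesis using permutation_idempotent_neighbour[OF assms(1) _ assms(3) \<pi>(1)] \<pi>(2) assms(2)
    by auto
next
  case False
  then obtain x where "x \<in> X" "x \<notin> ran f" by blast
  then show ?thesis using source_idempotent_neighbour[OF assms(2), of f x] assms(4) by blast
qed

section \<open>Bounds for the diameter\<close>

lemma diameter_le_5:
  assumes "finite X" "card X \<ge> 3" "\<not> prime (card X)"
  shows "diameter (commuting_graph (sym_inv X) (\<circ>\<^sub>m)) \<le> 5"
  unfolding diameter_def
proof (rule SUP_least, clarify)
  let ?V = "sym_inv X - {Map.empty, Some |` X}"
  fix a b
  assume "a \<in> pverts (commuting_graph (sym_inv X) (\<circ>\<^sub>m))" "b \<in> pverts (commuting_graph (sym_inv X) (\<circ>\<^sub>m))"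
  then have ab: "a \<in> ?V" "b \<in> ?V" by (simp_all add: verts_commuting_graph center_sym_inv)
  from idempotent_neighbour[OF assms ab(1)] obtain g A
    where g: "g \<in> ?V" "a \<circ>\<^sub>m g = g \<circ>\<^sub>m a" and A: "invariant g A" "A \<subset> X" "A \<noteq> {}" by blast
  from idempotent_neighbour[OF assms ab(2)] obtain k B
    where k: "k \<in> ?V" "b \<circ>\<^sub>m k = k \<circ>\<^sub>m b" and B: "invariant k B" "B \<subset> X" "B \<noteq> {}" by blast
  \<comment> \<open>Both products are the identity on the intersection of \<open>A\<close> and
    \<open>B\<close>. This is the middle edge of the path from \<open>a\<close> through
    \<open>g\<close> and \<open>k\<close> to \<open>b\<close>.\<close>
  have "(Some |` A) \<circ>\<^sub>m (Some |` B) = (Some |` B) \<circ>\<^sub>m (Some |` A)"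
    by (auto simp: fun_eq_iff map_comp_def restrict_map_def)
  with ab g k invariant_commute[OF A(1)] invariant_commute[OF B(1)]
    partial_identity_vertex[OF A(2,3)] partial_identity_vertex[OF B(2,3)]
  show "distance (commuting_graph (sym_inv X) (\<circ>\<^sub>m)) a b \<le> 5"
    by (intro distance_commuting_graph_le_5[of _ a g "Some |` A" "Some |` B" k b])
      (auto simp: center_sym_inv finite_sym_inv[OF assms(1)])
qed

theorem proposition6p13:
  fixes X :: "'a set"
  assumes "finite X" and "card X \<ge> 3" and "odd (card X)"
  shows "(prime (card X) \<longrightarrow> diameter (commuting_graph (sym_inv X) (\<circ>\<^sub>m)) = \<infinity>) \<and>
    (\<not> prime (card X) \<longrightarrow> diameter (commuting_graph (sym_inv X) (\<circ>\<^sub>m)) \<in> {4, 5})"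
proof -
  let ?V = "sym_inv X - {Map.empty, Some |` X}"
  let ?G = "commuting_graph (sym_inv X) (\<circ>\<^sub>m)"
  have V: "sym_inv X - semigroup_center (sym_inv X) (\<circ>\<^sub>m) = ?V" "pverts ?G = ?V"
    by (simp_all add: center_sym_inv verts_commuting_graph)
  have fin: "finite (sym_inv X)" using assms(1) by (rule finite_sym_inv)
  \<comment> \<open>One numbering serves both the cycle and the chain; the lower bound 4 relies on
    this common choice.\<close>
  obtain h where h: "bij_betw h {..<card X} X"
    using ex_bij_betw_nat_finite[OF assms(1)] by (auto simp: atLeast0LessThan)
  from full_cycle_exists[OF h] obtain c where c: "c \<in> sym_inv X" "full_cycle X h c" by blast
  from full_chain_exists[OF h] obtain f where f: "f \<in> sym_inv X" "full_chain X h f" by blast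
  have inj: "h i \<noteq> h 0" if "0 < i" "i < card X" for i
    using h that by (auto simp: bij_betw_def dest: inj_onD)
  have hX: "h i \<in> X" if "i < card X" for i using h that by (auto simp: bij_betw_def)
  have c0: "c (h 0) = Some (h 1)" using c(2) assms(2) by (simp add: full_cycle_def)
  have f0: "f (h 0) = Some (h 1)" and f1: "f (h (card X - 1)) = None"
    using f(2) assms(2) by (simp_all add: full_chain_def)
  have not_id: "a \<noteq> Some |` X" "a \<noteq> Map.empty" if "a (h 0) = Some (h 1)" for a
    using that inj[of 1] hX[of 0] assms(2) by auto
  have cV: "c \<in> ?V" and fV: "f \<in> ?V"
    using c(1) f(1) not_id[of c, OF c0] not_id[of f, OF f0] by auto
  have "diameter ?G = \<infinity>" if prime: "prime (card X)"
  proof -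
    have "distance ?G c f = \<infinity>"
    \<comment> \<open>The numbering is quantified because neighbours of a full cycle are full cycles
      in other numberings.\<close>
    proof (rule distance_commuting_graph_infinite[OF fin, where P = "\<lambda>y. \<exists>h. full_cycle X h y"])
      show "\<exists>h. full_cycle X h c" using c by blast
      show "\<not> (\<exists>h. full_cycle X h f)"
      \<comment> \<open>A full cycle is defined on all of \<open>X\<close>, whereas the chain
        \<open>f\<close> is undefined at its last point.\<close>
      proof clarify
        fix h' assume "full_cycle X h' f"
        moreover from this obtain i where "i < card X" "h (card X - 1) = h' i"
          using hX[of "card X - 1"] assms(2) by (auto simp: full_cycle_def bij_betw_def)
        ultimately show False using f1 by (simp add: full_cycle_def)
      qed
      fix x y
      assume "\<exists>h. full_cycle X h x" "y \<in> sym_inv X - semigroup_center (sym_inv X) (\<circ>\<^sub>m)"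
        "x \<circ>\<^sub>m y = y \<circ>\<^sub>m x"
      then show "\<exists>h. full_cycle X h y"
        unfolding V using full_cycle_neighbour_prime[OF prime] by blast
    qed
    then show ?thesis
      using distance_le_diameter[of c ?G f] cV fV V by simp
  qed
  moreover have "diameter ?G \<in> {4, 5}" if "\<not> prime (card X)"
  proof -
    have "4 \<le> distance ?G f c"
    proof (rule distance_commuting_graph_ge_4[OF fin], unfold V)
      fix x y assume "x \<in> ?V" "y \<in> ?V" "f \<circ>\<^sub>m x = x \<circ>\<^sub>m f" "y \<circ>\<^sub>m c = c \<circ>\<^sub>m y"
      then show "x \<circ>\<^sub>m y \<noteq> y \<circ>\<^sub>m x"
        by (intro chain_cycle_centralizers_not_commute[OF f(2) c(2)]) simp_all
    qed
    also have "\<dots> \<le> diameter ?G" using cV fV V by (intro distance_le_diameter) auto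
    finally have "4 \<le> diameter ?G" .
    moreover have "diameter ?G \<le> 5" using assms(1,2) that by (rule diameter_le_5)
    ultimately show ?thesis by (cases "diameter ?G") (auto simp: numeral_eq_enat)
  qed
  ultimately show ?thesis by blast
qed

end
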